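(* Let $A$ be a finite-dimensional nilpotent $n$-Lie algebra over a field $\mathbf{F}$ of characteristic zero. Then $A$ is elementary if and only if $A$ is abelian.
   Context: An $n$-Lie algebra ($n\ge 2$) over a field $\mathbf{F}$ is a vector space $A$ over $\mathbf{F}$ with an $n$-ary multilinear operation $[\,,\dots,\,]$ satisfying $[x_1,\dots,x_n]=\operatorname{sgn}(\sigma)[x_{\sigma(1)},\dots,x_{\sigma(n)}]$ for all $\sigma\in S_n$ and $[[x_1,\dots,x_n],y_2,\dots,y_n]=\sum_{i=1}^n[x_1,\dots,[x_i,y_2,\dots,y_n],\dots,x_n]$. For subspaces, $[V_1,\dots,V_n]$ denotes the linear span of all brackets $[v_1,\dots,v_n]$, $v_i\in V_i$. A subalgebra is a subspace $B$ with $[B,\dots,B]\subseteq B$; an ideal is a subspace $I$ with $[I,A,\dots,A]\subseteq I$. $A$ is abelian if $[A,\dots,A]=0$. $A$ is nilpotent if $A^r=0$ for some $r\ge 0$, where $A^0=A$ and $A^{s+1}=[A^s,A,\dots,A]$. A proper subalgebra $M$ is maximal if the only subalgebra properly containing $M$ is $A$ itself. The Frattini subalgebra $F(A)$ is the intersection of all maximal subalgebras of $A$ (with $F(0)=0$), and $\Phi(A)$ is the largest ideal of $A$ contained in $F(A)$. $A$ is elementary if $\Phi(C)=0$ for every subalgebra $C$ of $A$ (including $A$ itself). *)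

theory Defs
  imports Complex_Main "HOL-Combinatorics.Permutations"
begin

text \<open>
  The algebra is the whole type \<open>'v\<close>; subalgebras are subsets of it. The bracket takes its
  arguments as a list and only its values on lists of length \<open>n\<close> matter: every notion below
  evaluates it on such lists only. Lists are indexed from 0.
\<close>

locale n_Lie_algebra = vector_space scale
  for scale :: "'f::field \<Rightarrow> 'v::ab_group_add \<Rightarrow> 'v" (infixr \<open>*s\<close> 75) +
  fixes n :: nat
    and bracket :: "'v list \<Rightarrow> 'v"
  assumes n_ge_2: "n \<ge> 2"
    and bracket_multilinear:
      "\<And>xs i. length xs = n \<Longrightarrow> i < n \<Longrightarrow>
         Vector_Spaces.linear (*s) (*s) (\<lambda>x. bracket (xs[i := x]))"
    and bracket_skew:
      "\<And>xs \<sigma>. length xs = n \<Longrightarrow> \<sigma> permutes {..<n} \<Longrightarrow>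
         bracket xs = of_int (sign \<sigma>) *s bracket (map (\<lambda>i. xs ! \<sigma> i) [0..<n])"
    and bracket_Jacobi:
      "\<And>xs ys. length xs = n \<Longrightarrow> length ys = n - 1 \<Longrightarrow>
         bracket (bracket xs # ys) = (\<Sum>i<n. bracket (xs[i := bracket (xs ! i # ys)]))"
begin

text \<open>\<open>bracket_span [V\<^sub>1, \<dots>, V\<^sub>n]\<close> is the subspace written \<open>[V\<^sub>1, \<dots>, V\<^sub>n]\<close> in the literature.\<close>

definition bracket_span :: "'v set list \<Rightarrow> 'v set" where
  "bracket_span Vs = span {bracket vs | vs. list_all2 (\<in>) vs Vs}"

definition subalgebra :: "'v set \<Rightarrow> bool" where
  "subalgebra B \<longleftrightarrow> subspace B \<and> bracket_span (replicate n B) \<subseteq> B"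

text \<open>
  The remaining notions are relative to a subalgebra \<open>A\<close>, regarded as an \<open>n\<close>-Lie algebra in its
  own right; for the whole algebra, \<open>A = UNIV\<close>.
\<close>

definition ideal_of :: "'v set \<Rightarrow> 'v set \<Rightarrow> bool" where
  "ideal_of A I \<longleftrightarrow> subspace I \<and> I \<subseteq> A \<and> bracket_span (I # replicate (n - 1) A) \<subseteq> I"

definition abelian :: "'v set \<Rightarrow> bool" where
  "abelian A \<longleftrightarrow> bracket_span (replicate n A) = {0}"

primrec lower_central :: "'v set \<Rightarrow> nat \<Rightarrow> 'v set" where
  "lower_central A 0 = A"
| "lower_central A (Suc s) = bracket_span (lower_central A s # replicate (n - 1) A)"

definition nilpotent :: "'v set \<Rightarrow> bool" where
  "nilpotent A \<longleftrightarrow> (\<exists>r. lower_central A r = {0})"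

definition maximal_subalgebra :: "'v set \<Rightarrow> 'v set \<Rightarrow> bool" where
  "maximal_subalgebra A M \<longleftrightarrow> subalgebra M \<and> M \<subset> A \<and>
     (\<forall>B. subalgebra B \<and> M \<subset> B \<and> B \<subseteq> A \<longrightarrow> B = A)"

text \<open>
  Intersecting with \<open>A\<close> fixes the empty intersection: \<open>{0}\<close> has no maximal subalgebras, and its
  Frattini subalgebra comes out as \<open>{0}\<close>.
\<close>

definition Frattini_subalgebra :: "'v set \<Rightarrow> 'v set" where
  "Frattini_subalgebra A = A \<inter> \<Inter>{M. maximal_subalgebra A M}"

text \<open>Largest with respect to inclusion; it exists by \<open>Frattini_ideal_props\<close> below.\<close>

definition Frattini_ideal :: "'v set \<Rightarrow> 'v set" where
  "Frattini_ideal A = (GREATEST I. ideal_of A I \<and> I \<subseteq> Frattini_subalgebra A)"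

definition elementary :: "'v set \<Rightarrow> bool" where
  "elementary A \<longleftrightarrow> (\<forall>C. subalgebra C \<and> C \<subseteq> A \<longrightarrow> Frattini_ideal C = {0})"

lemma subspace_Frattini_subalgebra: "subalgebra A \<Longrightarrow> subspace (Frattini_subalgebra A)"
  unfolding Frattini_subalgebra_def
  by (intro subspace_inter subspace_Inter) (auto simp: subalgebra_def maximal_subalgebra_def)

lemma ideal_of_iff:
  "ideal_of A I \<longleftrightarrow> subspace I \<and> I \<subseteq> A \<and>
     (\<forall>x\<in>I. \<forall>ys. length ys = n - 1 \<longrightarrow> set ys \<subseteq> A \<longrightarrow> bracket (x # ys) \<in> I)"
proof -
  have "bracket_span (I # replicate (n - 1) A) \<subseteq> I \<longleftrightarrow>
      {bracket vs | vs. list_all2 (\<in>) vs (I # replicate (n - 1) A)} \<subseteq> I" if "subspace I"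
    unfolding bracket_span_def using that by (meson span_minimal span_superset subset_trans)
  moreover have "list_all2 (\<in>) ys (replicate m A) \<longleftrightarrow> length ys = m \<and> set ys \<subseteq> A" for ys m
    by (auto simp: list_all2_conv_all_nth subset_iff in_set_conv_nth)
  then have "{bracket vs | vs. list_all2 (\<in>) vs (I # replicate (n - 1) A)} \<subseteq> I \<longleftrightarrow>
      (\<forall>x\<in>I. \<forall>ys. length ys = n - 1 \<longrightarrow> set ys \<subseteq> A \<longrightarrow> bracket (x # ys) \<in> I)"
    unfolding list_all2_Cons2 by blast
  ultimately show ?thesis
    unfolding ideal_of_def by blast
qed

lemma linear_bracket_Cons:
  assumes "length ys = n - 1"
  shows "Vector_Spaces.linear (*s) (*s) (\<lambda>x. bracket (x # ys))"
  using bracket_multilinear[of "0 # ys" 0] assms n_ge_2 by simp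

lemma ideal_of_span_Union:
  assumes A: "subspace A" and ideals: "\<And>I. I \<in> \<I> \<Longrightarrow> ideal_of A I"
  shows "ideal_of A (span (\<Union>\<I>))"
  unfolding ideal_of_iff
proof (intro conjI ballI allI impI)
  show "subspace (span (\<Union>\<I>))" by simp
  show "span (\<Union>\<I>) \<subseteq> A"
    using ideals by (intro span_minimal[OF _ A]) (auto simp: ideal_of_def)
  fix x ys
  assume x: "x \<in> span (\<Union>\<I>)" and len: "length ys = n - 1" and ys: "set ys \<subseteq> A"
  interpret br: Vector_Spaces.linear "(*s)" "(*s)" "\<lambda>x. bracket (x # ys)"
    using len by (rule linear_bracket_Cons)
  from x show "bracket (x # ys) \<in> span (\<Union>\<I>)"
  proof (induction rule: span_induct_alt)
    case base
    then show ?case by (simp add: br.zero span_zero)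
  next
    case (step c x y)
    then obtain I where I: "I \<in> \<I>" "x \<in> I" by blast
    then have "bracket (x # ys) \<in> I"
      using ideals[of I] len ys by (simp add: ideal_of_iff)
    with I(1) have "bracket (x # ys) \<in> \<Union>\<I>" by blast
    with step.IH show ?case
      by (simp add: br.add br.scale span_add span_base span_scale)
  qed
qed

lemma Frattini_ideal_props:
  assumes "subalgebra A"
  shows "ideal_of A (Frattini_ideal A)"
    and "Frattini_ideal A \<subseteq> Frattini_subalgebra A"
    and "\<And>I. ideal_of A I \<Longrightarrow> I \<subseteq> Frattini_subalgebra A \<Longrightarrow> I \<subseteq> Frattini_ideal A"
proof -
  let ?P = "\<lambda>I. ideal_of A I \<and> I \<subseteq> Frattini_subalgebra A"
  let ?J = "span (\<Union>{I. ?P I})"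
  have J: "?P ?J"
  proof
    show "ideal_of A ?J"
      using assms by (intro ideal_of_span_Union) (simp_all add: subalgebra_def)
    show "?J \<subseteq> Frattini_subalgebra A"
      using assms by (intro span_minimal subspace_Frattini_subalgebra) blast+
  qed
  have max: "I \<subseteq> ?J" if "?P I" for I
    using that span_superset[of "\<Union>{I. ?P I}"] by blast
  have "Frattini_ideal A = ?J"
    unfolding Frattini_ideal_def by (rule Greatest_equality[where P = ?P, OF J max])
  with J max show "ideal_of A (Frattini_ideal A)"
    "Frattini_ideal A \<subseteq> Frattini_subalgebra A"
    "\<And>I. ideal_of A I \<Longrightarrow> I \<subseteq> Frattini_subalgebra A \<Longrightarrow> I \<subseteq> Frattini_ideal A"
    by auto
qed

end

end

theory Submission
  imports Defs
begin

text \<open>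
  An abelian algebra has every subspace as a subalgebra, so the maximal subalgebras of a subspace
  are its hyperplanes, and these meet in \<open>0\<close>.

  For the other direction it is enough that in a nilpotent \<open>A\<close> every maximal subalgebra \<open>M\<close>
  contains \<open>[A, \<dots>, A]\<close>: this is an ideal, so it then lies in \<open>\<Phi>(A)\<close>, which vanishes if \<open>A\<close> is
  elementary. To see that \<open>M\<close> contains it, take the last term \<open>A\<^sup>s\<close> of the lower central series
  that is not contained in \<open>M\<close>. Skew-symmetry makes the position of an argument irrelevant, so
  changing any arguments of a bracket by elements of \<open>A\<^sup>s\<close> changes its value only by an element
  of \<open>A\<^sup>s\<^sup>+\<^sup>1\<close>, hence of \<open>M\<close>. Therefore brackets of elements of \<open>M + A\<^sup>s\<close> are congruent to
  brackets of elements of \<open>M\<close> and lie in \<open>M\<close>. In particular \<open>M + A\<^sup>s\<close> is a subalgebra; by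
  maximality it is \<open>A\<close>, and the same congruence now says \<open>[A, \<dots>, A] \<subseteq> M\<close>.
\<close>

context n_Lie_algebra
begin

section \<open>Spans of brackets and congruences between brackets\<close>

lemma subspace_bracket_span: "subspace (bracket_span Vs)"
  unfolding bracket_span_def by simp

lemma bracket_in_bracket_span: "list_all2 (\<in>) vs Vs \<Longrightarrow> bracket vs \<in> bracket_span Vs"
  unfolding bracket_span_def by (auto intro: span_base)

lemma bracket_span_mono:
  assumes "list_all2 (\<subseteq>) Vs Ws"
  shows "bracket_span Vs \<subseteq> bracket_span Ws"
  unfolding bracket_span_def
proof (rule span_mono, safe)
  fix vs
  assume "list_all2 (\<in>) vs Vs"
  then have "list_all2 (\<in>) vs Ws"
    by (rule list_all2_trans[rotated, OF _ assms]) auto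
  then show "\<exists>ws. bracket vs = bracket ws \<and> list_all2 (\<in>) ws Ws"
    by blast
qed

lemma list_all2_in_replicate_iff:
  "list_all2 (\<in>) xs (replicate m A) \<longleftrightarrow> length xs = m \<and> set xs \<subseteq> A"
  by (auto simp: list_all2_conv_all_nth subset_iff in_set_conv_nth)

lemma bracket_span_replicate_subset_iff:
  assumes "subspace V"
  shows "bracket_span (replicate n A) \<subseteq> V \<longleftrightarrow>
    (\<forall>xs. length xs = n \<longrightarrow> set xs \<subseteq> A \<longrightarrow> bracket xs \<in> V)"
proof
  assume "bracket_span (replicate n A) \<subseteq> V"
  then show "\<forall>xs. length xs = n \<longrightarrow> set xs \<subseteq> A \<longrightarrow> bracket xs \<in> V"
    using bracket_in_bracket_span[of _ "replicate n A"]
    by (auto simp: list_all2_in_replicate_iff)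
next
  assume "\<forall>xs. length xs = n \<longrightarrow> set xs \<subseteq> A \<longrightarrow> bracket xs \<in> V"
  then show "bracket_span (replicate n A) \<subseteq> V"
    unfolding bracket_span_def
    by (intro span_minimal[OF _ assms]) (auto simp: list_all2_in_replicate_iff)
qed

lemma bracket_span_Cons_subset_derived:
  assumes "I \<subseteq> A"
  shows "bracket_span (I # replicate (n - 1) A) \<subseteq> bracket_span (replicate n A)"
proof -
  have "replicate n A = A # replicate (n - 1) A"
    using n_ge_2 by (cases n) auto
  then show ?thesis
    using assms by (auto intro!: bracket_span_mono list.rel_refl)
qed

text \<open>
  The transposition of \<open>0\<close> and \<open>i\<close> brings the entry to the front, where \<open>bracket_span\<close>
  expects it, at the cost of a sign.
\<close>

lemma bracket_in_bracket_span_any_position: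
  assumes len: "length xs = n" and i: "i < n" and in_I: "xs ! i \<in> I"
    and others: "\<And>j. j < n \<Longrightarrow> j \<noteq> i \<Longrightarrow> xs ! j \<in> A"
  shows "bracket xs \<in> bracket_span (I # replicate (n - 1) A)"
proof -
  let ?\<tau> = "transpose 0 i"
  let ?ys = "map (\<lambda>j. xs ! ?\<tau> j) [0..<n]"
  have perm: "?\<tau> permutes {..<n}"
    using i by (intro permutes_swap_id) auto
  have "?ys ! j \<in> (I # replicate (n - 1) A) ! j" if j: "j < n" for j
  proof (cases j)
    case 0
    then show ?thesis using in_I j by simp
  next
    case (Suc k)
    have "?\<tau> j \<noteq> i"
      using Suc by (auto simp: transpose_def)
    moreover have "?\<tau> j < n"
      using permutes_in_image[OF perm, of j] j by simp
    ultimately show ?thesis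
      using others j Suc by simp
  qed
  then have "list_all2 (\<in>) ?ys (I # replicate (n - 1) A)"
    using n_ge_2 by (simp add: list_all2_conv_all_nth)
  then have "bracket ?ys \<in> bracket_span (I # replicate (n - 1) A)"
    by (rule bracket_in_bracket_span)
  then show ?thesis
    unfolding bracket_skew[OF len perm] by (rule subspace_scale[OF subspace_bracket_span])
qed

text \<open>
  Multilinearity turns this difference into a sum of brackets each of which has one entry in
  \<open>I\<close>. The lemma makes it possible to compute brackets modulo the next term when \<open>I\<close> is a term
  of the lower central series.
\<close>

lemma bracket_diff_in_bracket_span:
  assumes A: "subspace A"
    and xs: "length xs = n" "set xs \<subseteq> A" and ys: "length ys = n" "set ys \<subseteq> A"
    and diff: "\<And>i. i < n \<Longrightarrow> xs ! i - ys ! i \<in> I"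
  shows "bracket xs - bracket ys \<in> bracket_span (I # replicate (n - 1) A)"
proof -
  let ?V = "bracket_span (I # replicate (n - 1) A)"
  \<comment> \<open>Passing from \<open>xs\<close> to \<open>ys\<close> one entry at a time keeps each difference a single bracket.\<close>
  have "bracket xs - bracket (take k ys @ drop k xs) \<in> ?V" if "k \<le> n" for k
    using that
  proof (induction k)
    case 0
    then show ?case by (simp add: subspace_0[OF subspace_bracket_span])
  next
    case (Suc k)
    define ws where "ws = take k ys @ drop k xs"
    have k: "k < n" and len: "length ws = n"
      using Suc.prems xs ys by (auto simp: ws_def)
    interpret br: Vector_Spaces.linear "(*s)" "(*s)" "\<lambda>x. bracket (ws[k := x])"
      using len k by (rule bracket_multilinear)
    have old: "ws[k := xs ! k] = ws"
      using k xs ys by (intro nth_equalityI) (auto simp: ws_def nth_append nth_list_update)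
    have new: "ws[k := ys ! k] = take (Suc k) ys @ drop (Suc k) xs"
      using k xs ys
      by (intro nth_equalityI) (auto simp: ws_def nth_append nth_list_update less_Suc_eq)
    have "ws ! j \<in> A" if "j < n" for j
      using that k xs ys by (auto simp: ws_def nth_append subset_iff)
    then have "bracket (ws[k := xs ! k - ys ! k]) \<in> ?V"
      using k len diff[OF k]
      by (intro bracket_in_bracket_span_any_position[where i = k]) auto
    then have "bracket ws - bracket (take (Suc k) ys @ drop (Suc k) xs) \<in> ?V"
      by (simp add: br.diff old new)
    moreover have "bracket xs - bracket ws \<in> ?V"
      using Suc by (simp add: ws_def)
    ultimately show ?case
      using subspace_add[OF subspace_bracket_span] by fastforce
  qed
  from this[of n] show ?thesis
    using xs ys by simp
qed

section \<open>Maximal subalgebras of nilpotent algebras\<close>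

lemma lower_central_subset:
  assumes "subalgebra A"
  shows "lower_central A s \<subseteq> A"
proof (induction s)
  case (Suc s)
  then show ?case
    using bracket_span_Cons_subset_derived[of "lower_central A s" A] assms
    by (auto simp: subalgebra_def)
qed simp

text \<open>
  Brackets of elements of \<open>M + A\<^sup>s\<close> agree with brackets of elements of \<open>M\<close> modulo
  \<open>A\<^sup>s\<^sup>+\<^sup>1\<close>. If \<open>s\<close> is the last index with \<open>A\<^sup>s\<close> not inside \<open>M\<close>, this modulus lies in \<open>M\<close>, and
  maximality forces \<open>M + A\<^sup>s = A\<close>.
\<close>

lemma derived_subset_maximal_subalgebra:
  assumes A: "subalgebra A" and nil: "nilpotent A" and M: "maximal_subalgebra A M"
  shows "bracket_span (replicate n A) \<subseteq> M"
proof -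
  have subM: "subspace M" "bracket_span (replicate n M) \<subseteq> M" "M \<subset> A" and subA: "subspace A"
    using M A by (auto simp: maximal_subalgebra_def subalgebra_def)
  obtain r where r: "lower_central A r \<subseteq> M"
  proof -
    from nil obtain r where "lower_central A r = {0}"
      by (auto simp: nilpotent_def)
    then have "lower_central A r \<subseteq> M"
      using subspace_0[OF subM(1)] by simp
    then show thesis by (rule that)
  qed
  have "\<not> lower_central A 0 \<subseteq> M"
    using subM(3) by auto
  with r obtain s where s: "\<not> lower_central A s \<subseteq> M" "lower_central A (Suc s) \<subseteq> M"
    using ex_least_nat_less[of "\<lambda>s. lower_central A s \<subseteq> M" r] by (metis order_refl)
  let ?L = "lower_central A s"
  have subL: "subspace ?L"
    using subA subspace_bracket_span by (cases s) auto
  define B where "B = {m + a | m a. m \<in> M \<and> a \<in> ?L}"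
  have subB: "subspace B"
    unfolding B_def by (rule subspace_sums[OF subM(1) subL])
  have MB: "M \<subseteq> B"
    using subspace_0[OF subL] by (force simp: B_def)
  have LB: "?L \<subseteq> B"
    using subspace_0[OF subM(1)] by (force simp: B_def)
  have BA: "B \<subseteq> A"
    using subM(3) lower_central_subset[OF A, of s] subspace_add[OF subA] by (auto simp: B_def)
  have bracket_B: "bracket xs \<in> M" if len: "length xs = n" and xs: "set xs \<subseteq> B" for xs
  proof -
    have "\<forall>i<n. \<exists>m. m \<in> M \<and> xs ! i - m \<in> ?L"
    proof safe
      fix i assume "i < n"
      then have "xs ! i \<in> B" using len xs by auto
      then show "\<exists>m. m \<in> M \<and> xs ! i - m \<in> ?L" by (force simp: B_def)
    qed
    then obtain f where f: "\<And>i. i < n \<Longrightarrow> f i \<in> M \<and> xs ! i - f i \<in> ?L"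
      by metis
    let ?ms = "map f [0..<n]"
    have ms: "set ?ms \<subseteq> M" using f by auto
    have "bracket xs - bracket ?ms \<in> lower_central A (Suc s)"
      unfolding lower_central.simps
      using len xs BA ms subM(3) f by (intro bracket_diff_in_bracket_span[OF subA]) auto
    then have "bracket xs - bracket ?ms \<in> M"
      using s(2) by blast
    moreover have "bracket ?ms \<in> M"
      using subM(2) ms by (simp add: bracket_span_replicate_subset_iff[OF subM(1)])
    ultimately show ?thesis
      using subspace_add[OF subM(1)] by fastforce
  qed
  have "subalgebra B"
    using subB bracket_B MB by (auto simp: subalgebra_def bracket_span_replicate_subset_iff)
  moreover have "M \<subset> B"
    using MB LB s(1) by blast
  ultimately have "B = A"
    using M BA by (auto simp: maximal_subalgebra_def)
  then show ?thesis
    using bracket_B by (simp add: bracket_span_replicate_subset_iff[OF subM(1)])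
qed

lemma ideal_of_derived:
  assumes "subalgebra A"
  shows "ideal_of A (bracket_span (replicate n A))"
  using assms bracket_span_Cons_subset_derived[of "bracket_span (replicate n A)" A]
  by (auto simp: ideal_of_def subalgebra_def subspace_bracket_span)

lemma derived_subset_Frattini_ideal:
  assumes A: "subalgebra A" and nil: "nilpotent A"
  shows "bracket_span (replicate n A) \<subseteq> Frattini_ideal A"
proof (rule Frattini_ideal_props(3)[OF A ideal_of_derived[OF A]])
  show "bracket_span (replicate n A) \<subseteq> Frattini_subalgebra A"
    using derived_subset_maximal_subalgebra[OF A nil] A
    by (auto simp: Frattini_subalgebra_def subalgebra_def)
qed

lemma elementary_imp_abelian:
  assumes A: "subalgebra A" and nil: "nilpotent A" and el: "elementary A"
  shows "abelian A"
proof -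
  have "Frattini_ideal A = {0}"
    using A el by (auto simp: elementary_def)
  then show ?thesis
    using derived_subset_Frattini_ideal[OF A nil] subspace_0[OF subspace_bracket_span]
    by (auto simp: abelian_def)
qed

section \<open>Frattini ideals in abelian algebras\<close>

lemma subalgebra_of_abelian_iff:
  assumes "abelian A" and "B \<subseteq> A"
  shows "subalgebra B \<longleftrightarrow> subspace B"
proof -
  have "bracket_span (replicate n B) \<subseteq> {0}"
    using assms bracket_span_mono[of "replicate n B" "replicate n A"]
    by (simp add: abelian_def list_all2_conv_all_nth)
  then show ?thesis
    using subspace_0[of B] by (auto simp: subalgebra_def)
qed

text \<open>
  A nonzero \<open>v\<close> in \<open>C\<close> is avoided by the hyperplane spanned by the other members of a basis of \<open>C\<close>
  that contains \<open>v\<close>.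
\<close>

lemma Frattini_subalgebra_of_abelian:
  assumes ab: "abelian A" and C: "subspace C" "C \<subseteq> A"
  shows "Frattini_subalgebra C \<subseteq> {0}"
proof
  fix v
  assume v: "v \<in> Frattini_subalgebra C"
  show "v \<in> {0}"
  proof (rule ccontr)
    assume "v \<notin> {0}"
    then have "independent {v}" and vC: "{v} \<subseteq> C"
      using v by (auto simp: Frattini_subalgebra_def)
    then obtain E where E: "{v} \<subseteq> E" "E \<subseteq> C" "independent E" "C \<subseteq> span E"
      using maximal_independent_subset_extend[of "{v}" C] by metis
    define M where "M = span (E - {v})"
    have "v \<notin> M"
      using E(1,3) by (auto simp: M_def dependent_def)
    have "M \<subseteq> C"
      unfolding M_def using E(2) C(1) by (intro span_minimal) auto
    have "maximal_subalgebra C M"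
      unfolding maximal_subalgebra_def
    proof (intro conjI allI impI)
      show "subalgebra M"
        using \<open>M \<subseteq> C\<close> C by (subst subalgebra_of_abelian_iff[OF ab]) (auto simp: M_def)
      show "M \<subset> C"
        using \<open>M \<subseteq> C\<close> \<open>v \<notin> M\<close> vC by blast
      fix B
      assume B: "subalgebra B \<and> M \<subset> B \<and> B \<subseteq> C"
      then have subB: "subspace B" by (simp add: subalgebra_def)
      obtain w where w: "w \<in> B" "w \<notin> M" using B by blast
      have "w \<in> span (insert v (E - {v}))"
        using w(1) B E(1,4) by (auto simp: insert_absorb)
      then have "v \<in> span (insert w (E - {v}))"
        by (rule in_span_insert) (use w(2) in \<open>simp add: M_def\<close>)
      moreover have "insert w (E - {v}) \<subseteq> B"
        using w(1) B span_superset[of "E - {v}"] by (auto simp: M_def)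
      ultimately have "v \<in> B"
        using span_minimal[OF _ subB] by blast
      with \<open>insert w (E - {v}) \<subseteq> B\<close> have "E \<subseteq> B" by blast
      then show "B = C"
        using span_minimal[OF _ subB] E(4) B by blast
    qed
    then show False
      using v \<open>v \<notin> M\<close> by (auto simp: Frattini_subalgebra_def)
  qed
qed

lemma abelian_imp_elementary:
  assumes "abelian A"
  shows "elementary A"
  unfolding elementary_def
proof (intro allI impI)
  fix C
  assume C: "subalgebra C \<and> C \<subseteq> A"
  then have "Frattini_ideal C \<subseteq> {0}"
    using Frattini_ideal_props(2)[of C] Frattini_subalgebra_of_abelian[OF assms, of C]
    by (auto simp: subalgebra_def)
  moreover have "subspace (Frattini_ideal C)"
    using C Frattini_ideal_props(1)[of C] by (simp add: ideal_of_def)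
  ultimately show "Frattini_ideal C = {0}"
    using subspace_0 by blast
qed

end

section \<open>Elementary nilpotent algebras\<close>

theorem theorem3p3:
  fixes scale :: "'f::field_char_0 \<Rightarrow> 'v::ab_group_add \<Rightarrow> 'v"
    and n :: nat
    and bracket :: "'v list \<Rightarrow> 'v"
    and Basis :: "'v set"
  assumes "n_Lie_algebra scale n bracket"
    and "finite_dimensional_vector_space scale Basis"
    and "n_Lie_algebra.nilpotent scale n bracket UNIV"
  shows "n_Lie_algebra.elementary scale n bracket UNIV \<longleftrightarrow>
    n_Lie_algebra.abelian scale n bracket UNIV"
proof -
  interpret n_Lie_algebra scale n bracket by fact
  have "subalgebra UNIV" by (simp add: subalgebra_def)
  then show ?thesis
    using elementary_imp_abelian abelian_imp_elementary assms(3) by blast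
qed

end
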